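(* Let $X$ be a Polish space and let $d$ be a bounded lower semi-continuous metric on $X$. Let $\mu_1,\mu_2$ be two Borel probability measures on $X$. Let $0\le \epsilon\le 1$ and $\delta\ge 0$. If $c_f$ is an $(\epsilon,\delta)$-Lipschitz classifier (with respect to $d$, $\mu_1$, $\mu_2$), then $$W_X(\mu_1,\mu_2)\ \ge\ \epsilon(1-\delta).$$
   Context: A lower semi-continuous metric on a Polish space $X$ is a metric $d:X\times X\to[0,\infty)$ that is lower semi-continuous for the product of the Polish topology; it need not induce the topology of $X$. Lipschitz is always with respect to $d$; measurable means Borel measurable for the Polish topology. For Borel probability measures, $W_X(\mu_1,\mu_2)=\inf_{\vartheta}\int_{X\times X} d(x,y)\,d\vartheta(x,y)$, the infimum being over all couplings $\vartheta$ of $\mu_1$ and $\mu_2$ (Borel probability measures on $X\times X$ with marginals $\mu_1,\mu_2$). For a measurable $f:X\to\mathbb R$, the associated binary classifier is $c_f=\mathbf 1_{\{f>0\}}-\mathbf 1_{\{f\le 0\}}$, and $f$ is called its classification function. For $\epsilon\ge0$ put $$\varepsilon(c_f,\epsilon;\mu_i,\mu_j)=\mu_i(\{x: f(x)\le \epsilon/2\})+\mu_j(\{x: f(x)>-\epsilon/2\}),$$ $$\mathrm{err}(f,\epsilon;\mu_1,\mu_2)=\min\big(\varepsilon(c_f,\epsilon;\mu_1,\mu_2),\ \varepsilon(c_f,\epsilon;\mu_2,\mu_1)\big).$$ The classifier $c_f$ is an $(\epsilon,\delta)$-Lipschitz classifier if $f$ is measurable, $f\in L_1(\mu_1)\cap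 L_1(\mu_2)$, $f$ is 1-Lipschitz with respect to $d$, and $\mathrm{err}(f,\epsilon;\mu_1,\mu_2)\le\delta$. *)

theory Defs
  imports "HOL-Probability.Probability"
begin

definition lower_semicontinuous :: "('a::topological_space \<Rightarrow> real) \<Rightarrow> bool" where
  "lower_semicontinuous g \<longleftrightarrow> (\<forall>x. \<forall>c<g x. \<forall>\<^sub>F y in nhds x. c < g y)"

text \<open>
  The ambient Polish space is a type of class \<^class>\<open>polish_space\<close>. Only its topology is used
  below: the metric \<open>d\<close> is independent of the class metric \<^const>\<open>dist\<close> and need not induce
  the topology.
\<close>

definition lsc_metric :: "('a::polish_space \<Rightarrow> 'a \<Rightarrow> real) \<Rightarrow> bool" where
  "lsc_metric d \<longleftrightarrow> Metric_space UNIV d \<and> lower_semicontinuous (\<lambda>(x, y). d x y)"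

definition borel_probability :: "'a::topological_space measure \<Rightarrow> bool" where
  "borel_probability \<mu> \<longleftrightarrow> prob_space \<mu> \<and> sets \<mu> = sets borel"

definition couplings ::
    "'a::polish_space measure \<Rightarrow> 'a measure \<Rightarrow> ('a \<times> 'a) measure set" where
  "couplings \<mu> \<nu> =
     {\<theta>. borel_probability \<theta> \<and> distr \<theta> borel fst = \<mu> \<and> distr \<theta> borel snd = \<nu>}"

definition wasserstein ::
    "('a::polish_space \<Rightarrow> 'a \<Rightarrow> real) \<Rightarrow> 'a measure \<Rightarrow> 'a measure \<Rightarrow> ennreal" where
  "wasserstein d \<mu> \<nu> = (INF \<theta>\<in>couplings \<mu> \<nu>. \<integral>\<^sup>+(x, y). ennreal (d x y) \<partial>\<theta>)"

definition binary_classifier :: "('a \<Rightarrow> real) \<Rightarrow> 'a \<Rightarrow> real" where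
  "binary_classifier f x = indicator {x. f x > 0} x - indicator {x. f x \<le> 0} x"

definition margin_error :: "('a \<Rightarrow> real) \<Rightarrow> real \<Rightarrow> 'a measure \<Rightarrow> 'a measure \<Rightarrow> real" where
  "margin_error f \<epsilon> \<mu> \<nu> = measure \<mu> {x. f x \<le> \<epsilon> / 2} + measure \<nu> {x. f x > - \<epsilon> / 2}"

definition err :: "('a \<Rightarrow> real) \<Rightarrow> real \<Rightarrow> 'a measure \<Rightarrow> 'a measure \<Rightarrow> real" where
  "err f \<epsilon> \<mu> \<nu> = min (margin_error f \<epsilon> \<mu> \<nu>) (margin_error f \<epsilon> \<nu> \<mu>)"

text \<open>
  A classifier does not determine its classification function, while the margin conditions
  depend on the latter; hence \<open>f\<close> is an explicit argument next to the classifier \<open>c\<close>.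
\<close>

definition lipschitz_classifier ::
    "('a::polish_space \<Rightarrow> 'a \<Rightarrow> real) \<Rightarrow> 'a measure \<Rightarrow> 'a measure \<Rightarrow> real \<Rightarrow> real
      \<Rightarrow> ('a \<Rightarrow> real) \<Rightarrow> ('a \<Rightarrow> real) \<Rightarrow> bool" where
  "lipschitz_classifier d \<mu> \<nu> \<epsilon> \<delta> c f \<longleftrightarrow>
     c = binary_classifier f \<and>
     f \<in> borel_measurable borel \<and> integrable \<mu> f \<and> integrable \<nu> f \<and>
     (\<forall>x y. \<bar>f x - f y\<bar> \<le> d x y) \<and>
     err f \<epsilon> \<mu> \<nu> \<le> \<delta>"

end

theory Submission
  imports Defs
begin

text \<open>
  The easy half of Kantorovich duality suffices: every coupling is tested against the Lipschitz
  function \<open>f\<close>. Suppose the minimum in the error is attained with \<open>\<mu>\<^sub>1\<close> in the first place.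
  Under any coupling, the first point satisfies \<open>f > \<epsilon>/2\<close> and the second \<open>f \<le> -\<epsilon>/2\<close> outside an
  event whose probability is at most the sum of the two marginal probabilities in the margin
  error, hence with probability at least \<open>1 - \<delta>\<close>. Where both hold, the values of \<open>f\<close> differ by at
  least \<open>\<epsilon>\<close>, and the Lipschitz bound turns this into a transport cost of at least \<open>\<epsilon>\<close>. So every
  coupling costs at least \<open>\<epsilon> (1 - \<delta>)\<close>.

  Since the Lipschitz bound controls \<open>\<bar>f x - f y\<bar>\<close>, exchanging the two coordinates settles the
  other order of the measures. For this reason the estimate, \<open>nn_integral_ge_margin\<close>, is stated
  for two arbitrary random variables on one probability space.
\<close>

text \<open>
  Markov's inequality for the event that \<open>U\<close> and \<open>V\<close> lie on opposite sides of the margin, whose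
  complement is estimated by the union bound.
\<close>

lemma (in prob_space) nn_integral_ge_margin:
  fixes U V c :: "'a \<Rightarrow> real" and s :: real
  assumes [measurable]: "random_variable borel U" "random_variable borel V"
    and s: "0 \<le> s"
    and cost: "\<And>\<omega>. \<bar>U \<omega> - V \<omega>\<bar> \<le> c \<omega>"
    and margin: "prob {\<omega> \<in> space M. U \<omega> \<le> s / 2} + prob {\<omega> \<in> space M. V \<omega> > - s / 2} \<le> \<delta>"
  shows "ennreal (s * (1 - \<delta>)) \<le> (\<integral>\<^sup>+\<omega>. ennreal (c \<omega>) \<partial>M)"
proof -
  define A where "A = {\<omega> \<in> space M. U \<omega> \<le> s / 2}"
  define B where "B = {\<omega> \<in> space M. V \<omega> > - s / 2}"
  have [measurable]: "A \<in> events" "B \<in> events"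
    unfolding A_def B_def by measurable
  define G where "G = space M - (A \<union> B)"
  have [measurable]: "G \<in> events"
    unfolding G_def by measurable
  have "prob (A \<union> B) \<le> prob A + prob B"
    by (rule measure_Un_le) measurable
  then have "1 - \<delta> \<le> prob G"
    using margin prob_compl[of "A \<union> B"] unfolding G_def A_def B_def by simp
  then have "ennreal (s * (1 - \<delta>)) \<le> ennreal (s * prob G)"
    using s by (intro ennreal_leI mult_left_mono)
  also have "\<dots> = (\<integral>\<^sup>+\<omega>. ennreal s * indicator G \<omega> \<partial>M)"
    using s by (simp add: nn_integral_cmult_indicator emeasure_eq_measure ennreal_mult)
  also have "\<dots> \<le> (\<integral>\<^sup>+\<omega>. ennreal (c \<omega>) \<partial>M)"
  proof (rule nn_integral_mono)
    fix \<omega> assume "\<omega> \<in> space M"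
    then have "\<omega> \<in> G \<Longrightarrow> s \<le> c \<omega>"
      using cost[of \<omega>] by (auto simp: G_def A_def B_def)
    then show "ennreal s * indicator G \<omega> \<le> ennreal (c \<omega>)"
      by (auto simp: indicator_def intro: ennreal_leI)
  qed
  finally show ?thesis .
qed

theorem theorem6p2p3:
  fixes d :: "'a::polish_space \<Rightarrow> 'a \<Rightarrow> real"
    and \<mu>\<^sub>1 \<mu>\<^sub>2 :: "'a measure"
    and f :: "'a \<Rightarrow> real"
    and \<epsilon> \<delta> :: real
  assumes "lsc_metric d"
    and "bounded (range (\<lambda>(x, y). d x y))"
    and "borel_probability \<mu>\<^sub>1"
    and "borel_probability \<mu>\<^sub>2"
    and "0 \<le> \<epsilon>" and "\<epsilon> \<le> 1"
    and "0 \<le> \<delta>"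
    and "lipschitz_classifier d \<mu>\<^sub>1 \<mu>\<^sub>2 \<epsilon> \<delta> (binary_classifier f) f"
  shows "wasserstein d \<mu>\<^sub>1 \<mu>\<^sub>2 \<ge> ennreal (\<epsilon> * (1 - \<delta>))"
  unfolding wasserstein_def
proof (rule INF_greatest)
  fix \<theta> assume \<theta>: "\<theta> \<in> couplings \<mu>\<^sub>1 \<mu>\<^sub>2"
  then interpret \<theta>: prob_space \<theta>
    by (simp add: couplings_def borel_probability_def)
  have sets_\<theta>: "sets \<theta> = sets (borel \<Otimes>\<^sub>M borel :: ('a \<times> 'a) measure)"
    using \<theta> unfolding borel_prod by (simp add: couplings_def borel_probability_def)
  have [measurable]: "fst \<in> measurable \<theta> borel" "snd \<in> measurable \<theta> borel"
    by (simp_all add: measurable_cong_sets[OF sets_\<theta> refl])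
  have marginals: "\<mu>\<^sub>1 = distr \<theta> borel fst" "\<mu>\<^sub>2 = distr \<theta> borel snd"
    using \<theta> by (simp_all add: couplings_def)
  have [measurable]: "f \<in> borel_measurable borel"
    and Lipschitz: "\<And>x y. \<bar>f x - f y\<bar> \<le> d x y"
    and err: "err f \<epsilon> \<mu>\<^sub>1 \<mu>\<^sub>2 \<le> \<delta>"
    using assms(8) by (auto simp: lipschitz_classifier_def)
  have tails:
    "measure \<mu>\<^sub>1 {x. f x \<le> t} = \<theta>.prob {z \<in> space \<theta>. f (fst z) \<le> t}"
    "measure \<mu>\<^sub>1 {x. f x > t} = \<theta>.prob {z \<in> space \<theta>. f (fst z) > t}"
    "measure \<mu>\<^sub>2 {x. f x \<le> t} = \<theta>.prob {z \<in> space \<theta>. f (snd z) \<le> t}"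
    "measure \<mu>\<^sub>2 {x. f x > t} = \<theta>.prob {z \<in> space \<theta>. f (snd z) > t}" for t
    unfolding marginals
    by (subst measure_distr; auto intro!: arg_cong[where f = \<theta>.prob])+
  consider "margin_error f \<epsilon> \<mu>\<^sub>1 \<mu>\<^sub>2 \<le> \<delta>" | "margin_error f \<epsilon> \<mu>\<^sub>2 \<mu>\<^sub>1 \<le> \<delta>"
    using err by (auto simp: err_def min_le_iff_disj)
  then show "ennreal (\<epsilon> * (1 - \<delta>)) \<le> (\<integral>\<^sup>+(x, y). ennreal (d x y) \<partial>\<theta>)"
  proof cases
    case 1
    have "ennreal (\<epsilon> * (1 - \<delta>)) \<le> (\<integral>\<^sup>+z. ennreal (d (fst z) (snd z)) \<partial>\<theta>)"
    proof (rule \<theta>.nn_integral_ge_margin)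
      show "\<bar>f (fst z) - f (snd z)\<bar> \<le> d (fst z) (snd z)" for z
        by (rule Lipschitz)
      show "\<theta>.prob {z \<in> space \<theta>. f (fst z) \<le> \<epsilon> / 2}
          + \<theta>.prob {z \<in> space \<theta>. f (snd z) > - \<epsilon> / 2} \<le> \<delta>"
        using 1 by (simp only: margin_error_def tails)
    qed (use assms(5) in simp_all)
    then show ?thesis
      by (simp add: case_prod_unfold)
  next
    case 2
    have "ennreal (\<epsilon> * (1 - \<delta>)) \<le> (\<integral>\<^sup>+z. ennreal (d (fst z) (snd z)) \<partial>\<theta>)"
    proof (rule \<theta>.nn_integral_ge_margin)
      show "\<bar>f (snd z) - f (fst z)\<bar> \<le> d (fst z) (snd z)" for z
        using Lipschitz[of "fst z" "snd z"] by (simp add: abs_minus_commute)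
      show "\<theta>.prob {z \<in> space \<theta>. f (snd z) \<le> \<epsilon> / 2}
          + \<theta>.prob {z \<in> space \<theta>. f (fst z) > - \<epsilon> / 2} \<le> \<delta>"
        using 2 by (simp only: margin_error_def tails)
    qed (use assms(5) in simp_all)
    then show ?thesis
      by (simp add: case_prod_unfold)
  qed
qed

end
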